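(* Let $\omega:[0,\infty)\to[0,\infty)$ be a non-decreasing continuous function such that $\omega(t)=0$ implies $t=0$. Let $y:[0,\infty)\to[0,\infty)$ be a continuous function and $$\int_0^\infty\omega\big(y(t)\big)\varphi(t)\,dt<\infty,$$ where $\varphi(t)>0$ is a continuous function on $[0,\infty)$. Assume that there exists a constant $C>0$ such that $$\lim_{t\to\infty}\Big(t-\frac{C}{\varphi(t)}\Big)=\infty,\qquad M:=\limsup_{t\to\infty}\frac{\max_{\xi\in[t-\frac{C}{\varphi(t)},\,t]}\varphi(\xi)}{\min_{\xi\in[t-\frac{C}{\varphi(t)},\,t]}\varphi(\xi)}<\infty,$$ and that $$y(t)-y(s)\le\int_s^t h(\xi)\,d\xi,\qquad 0\le s\le t,$$ where $h:[0,\infty)\to[0,\infty)$ is a (measurable) function with $$A:=\limsup_{t\to\infty}\frac{h(t)}{\varphi(t)}<\infty.$$ Then $$\lim_{t\to\infty}y(t)=0.$$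
   Context: The integral of the nonnegative function $h$ is the Lebesgue integral. *)

theory Defs
  imports "HOL-Analysis.Analysis"
begin

text \<open>The library's \<open>Max\<close> and \<open>Min\<close> are for finite sets only. The following are the greatest and
  least value attained on \<open>S\<close>; they are meaningful only when such a value exists, e.g. for a
  continuous function on a nonempty compact set.\<close>

definition max_on :: "'a set \<Rightarrow> ('a \<Rightarrow> real) \<Rightarrow> real"
  where "max_on S f = (GREATEST v. v \<in> f ` S)"

definition min_on :: "'a set \<Rightarrow> ('a \<Rightarrow> real) \<Rightarrow> real"
  where "min_on S f = (LEAST v. v \<in> f ` S)"

end

theory Submission
  imports Defs
begin

text \<open>
  Near a large time \<open>t\<close> the natural length scale is \<open>1 / \<phi> t\<close>. On the window
  \<open>[t - C / \<phi> t, t]\<close> the weight \<open>\<phi>\<close> varies by at most a constant factor \<open>m\<close>, and \<open>h \<le> a \<phi>\<close>, so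
  \<open>y\<close> increases at rate at most \<open>a m \<phi> t\<close> there. Hence if \<open>y t \<ge> \<epsilon>\<close>, then \<open>y \<ge> \<epsilon> / 2\<close> on the whole
  interval \<open>[t - \<delta> / \<phi> t, t]\<close> as soon as \<open>\<delta> \<le> C\<close> and \<open>a m \<delta> \<le> \<epsilon> / 2\<close>. On that interval the integrand
  \<open>\<omega> (y s) \<phi> s\<close> is at least \<open>\<omega> (\<epsilon> / 2) \<phi> t / m\<close>, so the interval contributes at least
  \<open>\<omega> (\<epsilon> / 2) \<delta> / m\<close> to the integral. The factors \<open>\<phi> t\<close> cancel, and this amount is positive and
  independent of \<open>t\<close>. Since the windows escape to infinity while the integral converges, its tail
  over \<open>[t - C / \<phi> t, \<infinity>)\<close> is eventually smaller than that, which excludes \<open>y t \<ge> \<epsilon>\<close>.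
  The two integral facts behind this are \<open>nn_integral_tail_less\<close> (the tails vanish) and
  \<open>nn_integral_ge_on_interval\<close> (a lower bound on a single interval); \<open>window_bounds\<close> turns the
  quotient of maximum and minimum into pointwise bounds.
\<close>

lemma le_max_on:
  fixes f :: "'a::topological_space \<Rightarrow> real"
  assumes "compact S" "continuous_on S f" "x \<in> S"
  shows "f x \<le> max_on S f"
proof -
  obtain z where z: "z \<in> S" "\<And>x. x \<in> S \<Longrightarrow> f x \<le> f z"
    using continuous_attains_sup[of S f] assms by blast
  have "max_on S f = f z"
    unfolding max_on_def by (rule Greatest_equality) (use z in auto)
  then show ?thesis using z(2)[OF assms(3)] by simp
qed

lemma min_on_attained:
  fixes f :: "'a::topological_space \<Rightarrow> real"
  assumes "compact S" "continuous_on S f" "S \<noteq> {}"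
  obtains z where "z \<in> S" "min_on S f = f z" "\<And>x. x \<in> S \<Longrightarrow> min_on S f \<le> f x"
proof -
  obtain z where z: "z \<in> S" "\<And>x. x \<in> S \<Longrightarrow> f z \<le> f x"
    using continuous_attains_inf[of S f] assms by blast
  have "min_on S f = f z"
    unfolding min_on_def by (rule Least_equality) (use z in auto)
  then show thesis using z that by simp
qed

text \<open>The form in which the oscillation hypothesis enters: any two values on the window differ at
  most by the factor \<open>m\<close>, because one lies below the maximum and the other above the minimum.\<close>

lemma window_bounds:
  fixes f :: "'a::topological_space \<Rightarrow> real"
  assumes "compact S" "continuous_on S f" "\<And>x. x \<in> S \<Longrightarrow> f x > 0"
    and ratio: "max_on S f / min_on S f \<le> m" and m: "m \<ge> 0"
    and x: "x \<in> S" and x': "x' \<in> S"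
  shows "f x \<le> m * f x'"
proof -
  obtain z where z: "z \<in> S" "min_on S f = f z" "\<And>x. x \<in> S \<Longrightarrow> min_on S f \<le> f x"
    using min_on_attained[OF assms(1,2)] x by blast
  have "f x \<le> max_on S f"
    using le_max_on[OF assms(1,2) x] .
  also have "\<dots> \<le> m * min_on S f"
    using ratio assms(3)[OF z(1)] z(2) by (simp add: divide_le_eq)
  also have "\<dots> \<le> m * f x'"
    using z(3)[OF x'] m by (rule mult_left_mono)
  finally show ?thesis .
qed

text \<open>The bound is allowed to be enlarged so that it can be taken at least \<open>1\<close>; this makes it safe
  to divide by.\<close>

lemma eventually_le_of_Limsup_finite:
  fixes f :: "'a \<Rightarrow> real"
  assumes "Limsup F (\<lambda>x. ereal (f x)) < \<infinity>"
  obtains b where "b \<ge> 1" "eventually (\<lambda>x. f x \<le> b) F"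
proof -
  obtain r where r: "Limsup F (\<lambda>x. ereal (f x)) < ereal r"
    using ereal_dense2[OF assms] by blast
  have "eventually (\<lambda>x. f x \<le> max r 1) F"
    using Limsup_lessD[OF r] by eventually_elim auto
  then show thesis using that[of "max r 1"] by simp
qed

text \<open>A finite measure that is absolutely continuous with density \<open>g\<close> is continuous from above
  along the half-lines, whose intersection is empty.\<close>

lemma nn_integral_tail_less:
  fixes g :: "real \<Rightarrow> ennreal"
  assumes g: "g \<in> borel_measurable lebesgue" and fin: "(\<integral>\<^sup>+t. g t \<partial>lebesgue) < \<infinity>"
    and "\<kappa> > 0"
  obtains T where "(\<integral>\<^sup>+t\<in>{T..}. g t \<partial>lebesgue) < \<kappa>"
proof -
  let ?N = "density lebesgue g"
  have em: "emeasure ?N {a..} = (\<integral>\<^sup>+t\<in>{a..}. g t \<partial>lebesgue)" for a :: real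
    by (rule emeasure_density[OF g]) simp
  have "emeasure ?N {real n..} \<noteq> \<infinity>" for n
  proof -
    have "emeasure ?N {real n..} \<le> (\<integral>\<^sup>+t. g t \<partial>lebesgue)"
      unfolding em by (rule nn_integral_mono) (auto simp: indicator_def)
    then show ?thesis using fin by (auto simp: less_top[symmetric] top_unique)
  qed
  moreover have "decseq (\<lambda>n. {real n..})"
    by (auto simp: decseq_def)
  ultimately have "(\<lambda>n. emeasure ?N {real n..}) \<longlonglongrightarrow> emeasure ?N (\<Inter>n. {real n..})"
    by (intro Lim_emeasure_decseq) auto
  moreover have "(\<Inter>n. {real n..}) = {}"
  proof -
    have "\<exists>n. x \<notin> {real n..}" for x :: real
      using reals_Archimedean2[of x] by (auto simp: not_le)
    then show ?thesis by blast
  qed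
  ultimately have "(\<lambda>n. emeasure ?N {real n..}) \<longlonglongrightarrow> 0"
    by simp
  then have "eventually (\<lambda>n. emeasure ?N {real n..} < \<kappa>) sequentially"
    using \<open>\<kappa> > 0\<close> by (rule order_tendstoD)
  then obtain n where "emeasure ?N {real n..} < \<kappa>"
    by (meson eventually_sequentially order_refl)
  then show thesis using that em by simp
qed

lemma nn_integral_ge_on_interval:
  fixes g :: "real \<Rightarrow> ennreal"
  assumes "s \<le> t" "{s..t} \<subseteq> S" "c \<ge> 0" "\<And>x. x \<in> {s..t} \<Longrightarrow> ennreal c \<le> g x"
  shows "ennreal (c * (t - s)) \<le> (\<integral>\<^sup>+x\<in>S. g x \<partial>lebesgue)"
proof -
  have "ennreal (c * (t - s)) = (\<integral>\<^sup>+x. ennreal c * indicator {s..t} x \<partial>lebesgue)"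
    using assms by (simp add: nn_integral_cmult_indicator ennreal_mult)
  also have "\<dots> \<le> (\<integral>\<^sup>+x\<in>S. g x \<partial>lebesgue)"
    by (rule nn_integral_mono) (use assms in \<open>auto simp: indicator_def\<close>)
  finally show ?thesis .
qed

lemma nn_integral_le_on_interval:
  fixes g :: "real \<Rightarrow> ennreal"
  assumes "s \<le> t" "c \<ge> 0" "\<And>x. x \<in> {s..t} \<Longrightarrow> g x \<le> ennreal c"
  shows "(\<integral>\<^sup>+x\<in>{s..t}. g x \<partial>lebesgue) \<le> ennreal (c * (t - s))"
proof -
  have "(\<integral>\<^sup>+x\<in>{s..t}. g x \<partial>lebesgue) \<le> (\<integral>\<^sup>+x. ennreal c * indicator {s..t} x \<partial>lebesgue)"
    by (rule nn_integral_mono) (use assms in \<open>auto simp: indicator_def\<close>)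
  also have "\<dots> = ennreal (c * (t - s))"
    using assms by (simp add: nn_integral_cmult_indicator ennreal_mult)
  finally show ?thesis .
qed

theorem corollary2p9:
  fixes \<omega> y \<phi> h :: "real \<Rightarrow> real" and C :: real
  assumes "\<omega> \<in> {0..} \<rightarrow> {0..}"
    and "mono_on {0..} \<omega>"
    and "continuous_on {0..} \<omega>"
    and "\<And>t. t \<ge> 0 \<Longrightarrow> \<omega> t = 0 \<Longrightarrow> t = 0"
    and "y \<in> {0..} \<rightarrow> {0..}"
    and "continuous_on {0..} y"
    and "\<And>t. t \<ge> 0 \<Longrightarrow> \<phi> t > 0"
    and "continuous_on {0..} \<phi>"
    and "(\<integral>\<^sup>+t\<in>{0..}. ennreal (\<omega> (y t) * \<phi> t) \<partial>lebesgue) < \<infinity>"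
    and "C > 0"
    and "filterlim (\<lambda>t. t - C / \<phi> t) at_top at_top"
    and "Limsup at_top (\<lambda>t. ereal (max_on {t - C / \<phi> t..t} \<phi> / min_on {t - C / \<phi> t..t} \<phi>)) < \<infinity>"
    and "h \<in> {0..} \<rightarrow> {0..}"
    and "h \<in> borel_measurable (lebesgue_on {0..})"
    and "\<And>s t. 0 \<le> s \<Longrightarrow> s \<le> t \<Longrightarrow>
           ereal (y t - y s) \<le> enn2ereal (\<integral>\<^sup>+\<xi>\<in>{s..t}. ennreal (h \<xi>) \<partial>lebesgue)"
    and "Limsup at_top (\<lambda>t. ereal (h t / \<phi> t)) < \<infinity>"
  shows "(y \<longlongrightarrow> 0) at_top"
proof -
  note \<omega>_nonneg = assms(1) and \<omega>_mono = assms(2) and \<omega>_cont = assms(3) and \<omega>_zero = assms(4)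
    and y_nonneg = assms(5) and y_cont = assms(6) and \<phi>_pos = assms(7) and \<phi>_cont = assms(8)
    and fin = assms(9) and C = assms(10) and y_growth = assms(15)
  define g where "g t = ennreal (\<omega> (y t) * \<phi> t) * indicator {0..} t" for t
  have g_meas: "g \<in> borel_measurable lebesgue"
  proof -
    have "continuous_on {0..} (\<lambda>t. \<omega> (y t) * \<phi> t)"
      using y_nonneg
      by (intro continuous_on_mult \<phi>_cont continuous_on_compose2[OF \<omega>_cont y_cont]) auto
    then have "(\<lambda>t. indicator {0..} t *\<^sub>R (\<omega> (y t) * \<phi> t)) \<in> borel_measurable borel"
      by (intro borel_measurable_continuous_on_indicator) auto
    then have "(\<lambda>t. ennreal (indicator {0..} t *\<^sub>R (\<omega> (y t) * \<phi> t))) \<in> borel_measurable lebesgue"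
      by (intro measurable_compose[OF _ measurable_ennreal] measurable_completion) simp
    also have "(\<lambda>t. ennreal (indicator {0..} t *\<^sub>R (\<omega> (y t) * \<phi> t))) = g"
      by (auto simp: g_def indicator_def)
    finally show ?thesis .
  qed
  have g_fin: "(\<integral>\<^sup>+t. g t \<partial>lebesgue) < \<infinity>"
    using fin by (simp add: g_def)
  obtain m where m: "m \<ge> 1"
    and ratio: "\<forall>\<^sub>F t in at_top. max_on {t - C / \<phi> t..t} \<phi> / min_on {t - C / \<phi> t..t} \<phi> \<le> m"
    using eventually_le_of_Limsup_finite[OF assms(12)] .
  obtain a where a: "a \<ge> 1" and h_le: "\<forall>\<^sub>F t in at_top. h t / \<phi> t \<le> a"
    using eventually_le_of_Limsup_finite[OF assms(16)] .
  obtain T0 where T0: "\<And>t. t \<ge> T0 \<Longrightarrow> h t / \<phi> t \<le> a"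
    using h_le unfolding eventually_at_top_linorder by blast
  have eventually_less: "\<forall>\<^sub>F t in at_top. y t < \<epsilon>" if \<epsilon>: "\<epsilon> > 0" for \<epsilon>
  proof -
    define \<delta> where "\<delta> = min C (\<epsilon> / (2 * a * m))"
    have \<delta>: "\<delta> > 0" "\<delta> \<le> C" "a * m * \<delta> \<le> \<epsilon> / 2"
    proof -
      show "\<delta> > 0" "\<delta> \<le> C"
        using C \<epsilon> a m by (auto simp: \<delta>_def)
      have "\<delta> \<le> \<epsilon> / (2 * a * m)" by (simp add: \<delta>_def)
      then show "a * m * \<delta> \<le> \<epsilon> / 2"
        using a m by (simp add: field_simps)
    qed
    have "\<omega> (\<epsilon> / 2) \<noteq> 0" "\<omega> (\<epsilon> / 2) \<ge> 0"
      using \<omega>_zero[of "\<epsilon> / 2"] \<omega>_nonneg \<epsilon> by auto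
    then have \<omega>_pos: "\<omega> (\<epsilon> / 2) > 0" by simp
    define \<kappa> where "\<kappa> = \<omega> (\<epsilon> / 2) * \<delta> / m"
    have "ennreal \<kappa> > 0"
      using \<omega>_pos \<delta>(1) m by (simp add: \<kappa>_def)
    then obtain T where T: "(\<integral>\<^sup>+t\<in>{T..}. g t \<partial>lebesgue) < ennreal \<kappa>"
      using nn_integral_tail_less[OF g_meas g_fin] by blast
    have "\<forall>\<^sub>F t in at_top. max (max T0 T) 0 \<le> t - C / \<phi> t"
      using assms(11) unfolding filterlim_at_top by blast
    then show ?thesis
      using ratio eventually_ge_at_top[of 0]
    proof eventually_elim
      case (elim t)
      define W where "W = {t - C / \<phi> t..t}"
      define s where "s = t - \<delta> / \<phi> t"
      have \<phi>t: "\<phi> t > 0" using \<phi>_pos elim(3) .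
      have "C / \<phi> t > 0" using C \<phi>t by simp
      then have tW: "t \<in> W" by (simp add: W_def)
      have W_sub: "W \<subseteq> {0..}" "W \<subseteq> {T0..}" "W \<subseteq> {T..}"
        using elim(1) by (auto simp: W_def)
      have "\<delta> / \<phi> t \<le> C / \<phi> t"
        using \<delta>(2) \<phi>t by (simp add: divide_right_mono)
      then have s_sub: "{s..t} \<subseteq> W" by (auto simp: s_def W_def)
      have s_le: "s \<le> t" using \<delta>(1) \<phi>t by (simp add: s_def)
      have osc: "\<phi> x \<le> m * \<phi> x'" if "x \<in> W" "x' \<in> W" for x x'
      proof (rule window_bounds[OF _ _ _ _ _ that])
        show "compact W" by (simp add: W_def)
        show "continuous_on W \<phi>" using \<phi>_cont W_sub(1) by (rule continuous_on_subset)
        show "\<And>x. x \<in> W \<Longrightarrow> \<phi> x > 0" using \<phi>_pos W_sub(1) by auto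
        show "max_on W \<phi> / min_on W \<phi> \<le> m" using elim(2) by (simp add: W_def)
      qed (use m in simp)
      show "y t < \<epsilon>"
      proof (rule ccontr)
        assume "\<not> y t < \<epsilon>"
        have y_ge: "y x \<ge> \<epsilon> / 2" if x: "x \<in> {s..t}" for x
        proof -
          have x_le: "x \<le> t" and x0: "0 \<le> x" using x s_sub W_sub(1) by auto
          have h_bound: "h u \<le> a * m * \<phi> t" if "u \<in> {x..t}" for u
          proof -
            have u: "u \<in> W" using that x s_sub by auto
            have "\<phi> u > 0" using u \<phi>_pos W_sub(1) by auto
            then have "h u \<le> a * \<phi> u"
              using T0[of u] u W_sub(2) by (auto simp: divide_le_eq)
            also have "\<dots> \<le> a * (m * \<phi> t)"
              using osc[OF u tW] a by (intro mult_left_mono) auto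
            finally show ?thesis by (simp add: mult.assoc)
          qed
          have rate: "0 \<le> a * m * \<phi> t" using a m \<phi>t by simp
          have "(\<integral>\<^sup>+u\<in>{x..t}. ennreal (h u) \<partial>lebesgue) \<le> ennreal (a * m * \<phi> t * (t - x))"
            using x_le rate h_bound by (intro nn_integral_le_on_interval ennreal_leI)
          then have "enn2ereal (\<integral>\<^sup>+u\<in>{x..t}. ennreal (h u) \<partial>lebesgue)
              \<le> enn2ereal (ennreal (a * m * \<phi> t * (t - x)))"
            by (simp add: less_eq_ennreal.rep_eq)
          also have "\<dots> = ereal (a * m * \<phi> t * (t - x))"
            using rate x_le by (intro enn2ereal_ennreal) simp
          finally have "y t - y x \<le> a * m * \<phi> t * (t - x)"
            using y_growth[OF x0 x_le] by (metis ereal_less_eq(3) order_trans)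
          also have "\<dots> \<le> a * m * \<phi> t * (\<delta> / \<phi> t)"
            using x rate by (intro mult_left_mono) (auto simp: s_def)
          also have "\<dots> \<le> \<epsilon> / 2"
            using \<delta>(3) \<phi>t by simp
          finally show ?thesis using \<open>\<not> y t < \<epsilon>\<close> by simp
        qed
        have g_ge: "ennreal (\<omega> (\<epsilon> / 2) * (\<phi> t / m)) \<le> g x" if x: "x \<in> {s..t}" for x
        proof -
          have xW: "x \<in> W" and x0: "x \<ge> 0" using x s_sub W_sub(1) by auto
          have "\<omega> (\<epsilon> / 2) \<le> \<omega> (y x)"
            using \<epsilon> y_ge[OF x] by (intro mono_onD[OF \<omega>_mono]) auto
          moreover have "\<phi> t / m \<le> \<phi> x"
            using osc[OF tW xW] m by (simp add: divide_le_eq mult.commute)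
          ultimately have "\<omega> (\<epsilon> / 2) * (\<phi> t / m) \<le> \<omega> (y x) * \<phi> x"
            using \<omega>_pos \<phi>t m by (intro mult_mono) auto
          then show ?thesis
            using x0 by (simp add: g_def ennreal_leI)
        qed
        have "ennreal (\<omega> (\<epsilon> / 2) * (\<phi> t / m) * (t - s)) \<le> (\<integral>\<^sup>+x\<in>{T..}. g x \<partial>lebesgue)"
          using s_le s_sub W_sub(3) \<omega>_pos \<phi>t m g_ge
          by (intro nn_integral_ge_on_interval) auto
        moreover have "\<omega> (\<epsilon> / 2) * (\<phi> t / m) * (t - s) = \<kappa>"
          using \<phi>t by (simp add: s_def \<kappa>_def)
        ultimately show False using T by simp
      qed
    qed
  qed
  show ?thesis
  proof (rule order_tendstoI)
    fix b :: real assume "b < 0"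
    show "\<forall>\<^sub>F t in at_top. b < y t"
      using eventually_ge_at_top[of 0]
      proof eventually_elim
      case (elim t)
      then have "y t \<ge> 0" using y_nonneg by auto
      then show ?case using \<open>b < 0\<close> by simp
    qed
  qed (rule eventually_less)
qed

end
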